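(* Let $\rho,\sigma$ be positive definite density operators on $\mathbb C^d$, $d\ge2$, and let $P=(P_j)_{j=1}^d$ be a rank-one PVM. Put $t_j=\mathrm{Tr}(\rho P_j)/\mathrm{Tr}(\sigma P_j)$, $\Gamma_P=\sum_jt_jP_j$, $G_P=2\rho-\sigma\Gamma_P-\Gamma_P\sigma$, $c_P=\|[\Gamma_P,G_P]\|_2$. Suppose the scores $t_1,\dots,t_d$ are pairwise distinct, let $\delta_P=\min_{j\ne k}|t_j-t_k|$, and suppose $c_P<\lambda_{\min}(\sigma)\,\delta_P^2$. Then there is a rank-one PVM $P^\star=(P_j^\star)_{j=1}^d$, suitably labeled, which is optimal for the measured $\chi^2$ divergence, i.e. $F_{h_1}(P^\star)=D^{\mathbb M}_{h_1}(\rho\Vert\sigma)$, and which satisfies $$\left(\frac12\sum_{j=1}^d\|P_j-P_j^\star\|_2^2\right)^{1/2}\le\frac{\sqrt d\,c_P}{\lambda_{\min}(\sigma)\,\delta_P^2}.$$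
   Context: A rank-one PVM on $\mathbb C^d$ is $P=(P_1,\dots,P_d)$, the rank-one projections onto the vectors of an orthonormal basis. $\|\cdot\|_2$ is the Hilbert–Schmidt norm and $\lambda_{\min}$ the smallest eigenvalue. The generator is $h_1(t)=(t-1)^2$; for $p_j=\mathrm{Tr}(\rho P_j)$, $q_j=\mathrm{Tr}(\sigma P_j)$, $F_{h_1}(P)=\sum_jq_j(p_j/q_j-1)^2$, and $D^{\mathbb M}_{h_1}(\rho\Vert\sigma)=\sup_M\sum_y\mathrm{Tr}(\sigma M_y)\bigl(\mathrm{Tr}(\rho M_y)/\mathrm{Tr}(\sigma M_y)-1\bigr)^2$, the supremum over all finite POVMs $M=(M_y)$ ($M_y\ge0$, $\sum_yM_y=\mathbf 1$; zero effects contribute $0$). *)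

theory Defs
  imports "HOL-Analysis.Analysis"
begin

text \<open>
  Operators on \<open>d\<close>-dimensional complex space are matrices of type \<open>complex ^ 'n ^ 'n\<close>,
  where \<open>d\<close> is \<open>CARD('n)\<close>.
\<close>

definition cinner :: "complex ^ 'n \<Rightarrow> complex ^ 'n \<Rightarrow> complex" where
  "cinner x y = (\<Sum>i\<in>UNIV. cnj (x $ i) * y $ i)"

definition cadjoint :: "complex ^ 'n ^ 'n \<Rightarrow> complex ^ 'n ^ 'n" where
  "cadjoint A = (\<chi> i j. cnj (A $ j $ i))"

definition hermitian :: "complex ^ 'n ^ 'n \<Rightarrow> bool" where
  "hermitian A \<longleftrightarrow> cadjoint A = A"

text \<open>For Hermitian \<open>A\<close> the number \<open>cinner x (A *v x)\<close> is real, so nothing is lost by \<open>Re\<close>.\<close>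

definition pos_semidef :: "complex ^ 'n ^ 'n \<Rightarrow> bool" where
  "pos_semidef A \<longleftrightarrow> hermitian A \<and> (\<forall>x. 0 \<le> Re (cinner x (A *v x)))"

definition pos_def :: "complex ^ 'n ^ 'n \<Rightarrow> bool" where
  "pos_def A \<longleftrightarrow> hermitian A \<and> (\<forall>x. x \<noteq> 0 \<longrightarrow> 0 < Re (cinner x (A *v x)))"

definition density_operator :: "complex ^ 'n ^ 'n \<Rightarrow> bool" where
  "density_operator A \<longleftrightarrow> pos_semidef A \<and> trace A = 1"

definition eigenvalue :: "complex ^ 'n ^ 'n \<Rightarrow> complex \<Rightarrow> bool" where
  "eigenvalue A l \<longleftrightarrow> (\<exists>x. x \<noteq> 0 \<and> A *v x = l *s x)"

text \<open>Only meaningful for Hermitian matrices, all of whose eigenvalues are real.\<close>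

definition lambda_min :: "complex ^ 'n ^ 'n \<Rightarrow> real" where
  "lambda_min A = Min {r. eigenvalue A (complex_of_real r)}"

definition commutator :: "complex ^ 'n ^ 'n \<Rightarrow> complex ^ 'n ^ 'n \<Rightarrow> complex ^ 'n ^ 'n" where
  "commutator A B = A ** B - B ** A"

definition hs_norm :: "complex ^ 'n ^ 'n \<Rightarrow> real" where
  "hs_norm A = sqrt (Re (trace (cadjoint A ** A)))"

text \<open>The library norm on \<open>complex ^ 'n ^ 'n\<close> is the Hilbert--Schmidt norm.\<close>

lemma hs_norm_eq_norm: "hs_norm A = norm A"
proof -
  have "Re (trace (cadjoint A ** A)) = (\<Sum>i\<in>UNIV. \<Sum>k\<in>UNIV. (cmod (A $ k $ i))\<^sup>2)"
    by (simp add: trace_def matrix_matrix_mult_def cadjoint_def cmod_power2 flip: power2_eq_square)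
  also have "\<dots> = (\<Sum>k\<in>UNIV. \<Sum>i\<in>UNIV. (cmod (A $ k $ i))\<^sup>2)"
    by (rule sum.swap)
  finally show ?thesis
    by (simp add: hs_norm_def norm_vec_def L2_set_def sum_nonneg)
qed

definition rank_one_proj :: "complex ^ 'n \<Rightarrow> complex ^ 'n ^ 'n" where
  "rank_one_proj v = (\<chi> i j. v $ i * cnj (v $ j))"

text \<open>
  The outcomes are labelled by \<open>'n\<close> itself, so an orthonormal family \<open>v\<close> consists of \<open>d\<close> vectors
  and is automatically a basis.
\<close>

definition rank_one_pvm :: "('n \<Rightarrow> complex ^ 'n ^ 'n) \<Rightarrow> bool" where
  "rank_one_pvm P \<longleftrightarrow>
    (\<exists>v. (\<forall>j k. cinner (v j) (v k) = (if j = k then 1 else 0)) \<and> (\<forall>j. P j = rank_one_proj (v j)))"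

definition povm :: "nat \<Rightarrow> (nat \<Rightarrow> complex ^ 'n ^ 'n) \<Rightarrow> bool" where
  "povm m M \<longleftrightarrow> (\<forall>y<m. pos_semidef (M y)) \<and> (\<Sum>y<m. M y) = mat 1"

text \<open>Traces against Hermitian effects are real, hence \<open>Re\<close>.\<close>

definition outcome_prob :: "complex ^ 'n ^ 'n \<Rightarrow> complex ^ 'n ^ 'n \<Rightarrow> real" where
  "outcome_prob \<rho> E = Re (trace (\<rho> ** E))"

text \<open>
  For positive definite \<open>\<sigma>\<close>, the denominator vanishes only when the effect is zero; such
  outcomes contribute \<open>0 * h (0 / 0) = 0\<close>, as they should.
\<close>

definition outcome_div ::
  "(real \<Rightarrow> real) \<Rightarrow> complex ^ 'n ^ 'n \<Rightarrow> complex ^ 'n ^ 'n \<Rightarrow> 'i set \<Rightarrow> ('i \<Rightarrow> complex ^ 'n ^ 'n) \<Rightarrow> real"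
  where
  "outcome_div h \<rho> \<sigma> Y M =
    (\<Sum>y\<in>Y. outcome_prob \<sigma> (M y) * h (outcome_prob \<rho> (M y) / outcome_prob \<sigma> (M y)))"

definition h1 :: "real \<Rightarrow> real" where
  "h1 t = (t - 1)\<^sup>2"

definition pvm_div ::
  "(real \<Rightarrow> real) \<Rightarrow> complex ^ 'n ^ 'n \<Rightarrow> complex ^ 'n ^ 'n \<Rightarrow> ('n \<Rightarrow> complex ^ 'n ^ 'n) \<Rightarrow> real" where
  "pvm_div h \<rho> \<sigma> P = outcome_div h \<rho> \<sigma> UNIV P"

text \<open>Taken in \<open>ereal\<close>, so that the supremum is genuine without a prior boundedness argument.\<close>

definition measured_div ::
  "(real \<Rightarrow> real) \<Rightarrow> complex ^ 'n ^ 'n \<Rightarrow> complex ^ 'n ^ 'n \<Rightarrow> ereal" where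
  "measured_div h \<rho> \<sigma> = Sup {ereal (outcome_div h \<rho> \<sigma> {..<m} M) | m M. povm m M}"

definition score ::
  "complex ^ 'n ^ 'n \<Rightarrow> complex ^ 'n ^ 'n \<Rightarrow> ('n \<Rightarrow> complex ^ 'n ^ 'n) \<Rightarrow> 'n \<Rightarrow> real" where
  "score \<rho> \<sigma> P j = outcome_prob \<rho> (P j) / outcome_prob \<sigma> (P j)"

definition score_operator ::
  "complex ^ 'n ^ 'n \<Rightarrow> complex ^ 'n ^ 'n \<Rightarrow> ('n \<Rightarrow> complex ^ 'n ^ 'n) \<Rightarrow> complex ^ 'n ^ 'n" where
  "score_operator \<rho> \<sigma> P = (\<Sum>j\<in>UNIV. score \<rho> \<sigma> P j *\<^sub>R P j)"

definition residual_operator ::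
  "complex ^ 'n ^ 'n \<Rightarrow> complex ^ 'n ^ 'n \<Rightarrow> ('n \<Rightarrow> complex ^ 'n ^ 'n) \<Rightarrow> complex ^ 'n ^ 'n" where
  "residual_operator \<rho> \<sigma> P =
    2 *\<^sub>R \<rho> - \<sigma> ** score_operator \<rho> \<sigma> P - score_operator \<rho> \<sigma> P ** \<sigma>"

definition commutator_defect ::
  "complex ^ 'n ^ 'n \<Rightarrow> complex ^ 'n ^ 'n \<Rightarrow> ('n \<Rightarrow> complex ^ 'n ^ 'n) \<Rightarrow> real" where
  "commutator_defect \<rho> \<sigma> P = hs_norm (commutator (score_operator \<rho> \<sigma> P) (residual_operator \<rho> \<sigma> P))"

definition score_gap ::
  "complex ^ 'n ^ 'n \<Rightarrow> complex ^ 'n ^ 'n \<Rightarrow> ('n \<Rightarrow> complex ^ 'n ^ 'n) \<Rightarrow> real" where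
  "score_gap \<rho> \<sigma> P = Min {\<bar>score \<rho> \<sigma> P j - score \<rho> \<sigma> P k\<bar> | j k. j \<noteq> k}"

end

theory Submission
  imports Defs
begin

text \<open>
  The Lyapunov equation \<open>\<sigma> \<Lambda> + \<Lambda> \<sigma> = 2 \<rho>\<close> has a unique solution \<open>\<Lambda>\<close>, which is Hermitian, and completing
  the square shows that every eigenbasis of \<open>\<Lambda>\<close> is optimal for the measured \<open>\<chi>\<^sup>2\<close> divergence.
  The difference \<open>X = \<Lambda> - \<Gamma>\<^sub>P\<close> satisfies \<open>\<sigma> X + X \<sigma> = G\<^sub>P\<close>, so \<open>2 \<lambda> \<parallel>X\<parallel> \<le> \<parallel>G\<^sub>P\<parallel>\<close>, where \<open>\<lambda>\<close> is the smallest
  eigenvalue of \<open>\<sigma>\<close>. In the basis of \<open>P\<close>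
  the diagonal of \<open>G\<^sub>P\<close> vanishes and \<open>[\<Gamma>\<^sub>P, G\<^sub>P]\<close> has entries \<open>(t\<^sub>j - t\<^sub>k) G\<^sub>j\<^sub>k\<close>, so \<open>\<delta>\<^sub>P \<parallel>G\<^sub>P\<parallel> \<le> c\<^sub>P\<close>.
  Hence \<open>2 \<parallel>X\<parallel> / \<delta>\<^sub>P \<le> c\<^sub>P / (\<lambda> \<delta>\<^sub>P\<^sup>2) < 1\<close>, and a Davis--Kahan argument compares the eigenbases of
  \<open>\<Gamma>\<^sub>P\<close> and \<open>\<Lambda>\<close>.
\<close>

section \<open>Complex inner product and adjoints\<close>

lemma cinner_add_right: "cinner x (y + z) = cinner x y + cinner x z"
  by (simp add: cinner_def algebra_simps sum.distrib)

lemma cinner_diff_right: "cinner x (y - z) = cinner x y - cinner x z"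
  by (simp add: cinner_def algebra_simps sum_subtractf)

lemma cinner_scale_right: "cinner x (c *s y) = c * cinner x y"
  by (simp add: cinner_def sum_distrib_left algebra_simps)

lemma cinner_scaleR_right: "cinner x (r *\<^sub>R y) = of_real r * cinner x y"
  by (simp add: cinner_def sum_distrib_left scaleR_conv_of_real[where 'a=complex] algebra_simps)

lemma cinner_sum_right: "cinner x (\<Sum>i\<in>S. f i) = (\<Sum>i\<in>S. cinner x (f i))"
  by (simp add: cinner_def sum_distrib_left) (rule sum.swap)

lemma cnj_cinner: "cnj (cinner x y) = cinner y x"
  by (simp add: cinner_def mult.commute)

lemma inner_eq_Re_cinner: "x \<bullet> y = Re (cinner x y)"
  by (simp add: inner_vec_def cinner_def inner_complex_def)

lemma cinner_self: "cinner x x = of_real ((norm x)\<^sup>2)"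
proof (rule complex_eqI)
  show "Re (cinner x x) = Re (of_real ((norm x)\<^sup>2))"
    by (simp flip: inner_eq_Re_cinner add: power2_norm_eq_inner)
  show "Im (cinner x x) = Im (of_real ((norm x)\<^sup>2))"
    by (simp add: cinner_def mult.commute)
qed

lemma cinner_adjoint_left: "cinner (cadjoint A *v x) y = cinner x (A *v y)"
proof -
  have "cinner (cadjoint A *v x) y = (\<Sum>i\<in>UNIV. \<Sum>j\<in>UNIV. cnj (x $ j) * A $ j $ i * y $ i)"
    by (simp add: cinner_def cadjoint_def matrix_vector_mult_def sum_distrib_right sum_distrib_left algebra_simps)
  also have "\<dots> = (\<Sum>j\<in>UNIV. \<Sum>i\<in>UNIV. cnj (x $ j) * A $ j $ i * y $ i)"
    by (rule sum.swap)
  also have "\<dots> = cinner x (A *v y)"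
    by (simp add: cinner_def matrix_vector_mult_def sum_distrib_left algebra_simps)
  finally show ?thesis .
qed

lemma cinner_hermitian: "hermitian A \<Longrightarrow> cinner (A *v x) y = cinner x (A *v y)"
  by (metis cinner_adjoint_left hermitian_def)

lemma cinner_hermitian_self:
  assumes "hermitian A"
  shows "cinner x (A *v x) = of_real (Re (cinner x (A *v x)))"
proof -
  have "cnj (cinner x (A *v x)) = cinner x (A *v x)"
    by (simp add: cnj_cinner cinner_hermitian[OF assms])
  then show ?thesis
    by (simp add: complex_eq_iff)
qed

lemma cadjoint_cadjoint [simp]: "cadjoint (cadjoint A) = A"
  by (simp add: cadjoint_def vec_eq_iff)

lemma cadjoint_mult: "cadjoint (A ** B) = cadjoint B ** cadjoint A"
  by (simp add: cadjoint_def vec_eq_iff matrix_matrix_mult_def mult.commute)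

lemma cadjoint_add: "cadjoint (A + B) = cadjoint A + cadjoint B"
  by (simp add: cadjoint_def vec_eq_iff)

lemma cadjoint_diff: "cadjoint (A - B) = cadjoint A - cadjoint B"
  by (simp add: cadjoint_def vec_eq_iff)

lemma cadjoint_scaleR: "cadjoint (r *\<^sub>R A) = r *\<^sub>R cadjoint A"
  by (simp add: cadjoint_def vec_eq_iff)

lemma cadjoint_sum: "cadjoint (\<Sum>i\<in>S. f i) = (\<Sum>i\<in>S. cadjoint (f i))"
  by (simp add: cadjoint_def vec_eq_iff)

lemma cadjoint_mat_1 [simp]: "cadjoint (mat 1) = mat 1"
  by (simp add: cadjoint_def vec_eq_iff mat_def)

lemma hermitian_rank_one_proj: "hermitian (rank_one_proj v)"
  by (simp add: hermitian_def cadjoint_def rank_one_proj_def vec_eq_iff)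

lemma rank_one_proj_mult_vec: "rank_one_proj v *v x = cinner v x *s v"
  by (simp add: rank_one_proj_def matrix_vector_mult_def cinner_def vec_eq_iff sum_distrib_left mult_ac)

lemma pos_semidef_rank_one_proj: "pos_semidef (rank_one_proj v)"
proof -
  have "cinner x (rank_one_proj v *v x) = of_real ((cmod (cinner v x))\<^sup>2)" for x
    by (metis (no_types) cinner_scale_right cnj_cinner complex_norm_square rank_one_proj_mult_vec)
  then show ?thesis
    by (simp add: pos_semidef_def hermitian_rank_one_proj)
qed

lemma pos_def_imp_pos_semidef: "pos_def A \<Longrightarrow> pos_semidef A"
  unfolding pos_def_def pos_semidef_def
  by (metis cinner_self inner_eq_Re_cinner inner_zero_left order_less_imp_le order_refl)

lemma inner_rank_one_proj:
  "rank_one_proj v \<bullet> rank_one_proj w = (cmod (cinner v w))\<^sup>2"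
proof -
  have "rank_one_proj v \<bullet> rank_one_proj w
      = Re (\<Sum>i\<in>UNIV. \<Sum>j\<in>UNIV. cnj (v $ i * cnj (v $ j)) * (w $ i * cnj (w $ j)))"
    by (simp add: inner_vec_def rank_one_proj_def inner_complex_def algebra_simps)
  also have "(\<Sum>i\<in>UNIV. \<Sum>j\<in>UNIV. cnj (v $ i * cnj (v $ j)) * (w $ i * cnj (w $ j)))
      = cinner v w * cnj (cinner v w)"
    by (simp add: cinner_def sum_product mult_ac) (rule sum.swap)
  also have "Re \<dots> = (cmod (cinner v w))\<^sup>2"
    by (simp flip: complex_norm_square)
  finally show ?thesis .
qed

text \<open>Expanding the square leaves two unit terms and minus twice the squared overlap. This
  converts the distance in the theorem into the overlap defects that the perturbation argument
  controls.\<close>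

lemma norm_rank_one_proj_diff:
  assumes "norm v = 1" and "norm w = 1"
  shows "(norm (rank_one_proj v - rank_one_proj w))\<^sup>2 = 2 * (1 - (cmod (cinner v w))\<^sup>2)"
proof -
  have "cmod (cinner v v) = 1" "cmod (cinner w w) = 1" "cmod (cinner w v) = cmod (cinner v w)"
    using assms by (auto simp: cinner_self) (metis cnj_cinner complex_mod_cnj)
  then show ?thesis
    by (simp add: power2_norm_eq_inner[of "rank_one_proj v - rank_one_proj w"]
        inner_diff_left inner_diff_right inner_rank_one_proj)
qed

section \<open>Matrix algebra, traces and the Hilbert-Schmidt inner product\<close>

lemma matrix_diff_ldistrib: "A ** (B - C) = A ** B - A ** (C :: 'a::ring_1 ^ 'p ^ 'n)"
  by (simp add: matrix_matrix_mult_def vec_eq_iff algebra_simps sum_subtractf)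

lemma matrix_diff_rdistrib: "(A - B) ** C = A ** C - B ** (C :: 'a::ring_1 ^ 'p ^ 'n)"
  by (simp add: matrix_matrix_mult_def vec_eq_iff algebra_simps sum_subtractf)

lemma matrix_add_rdistrib: "(A + B) ** C = A ** C + B ** (C :: 'a::semiring_1 ^ 'p ^ 'n)"
  by (simp add: matrix_matrix_mult_def vec_eq_iff algebra_simps sum.distrib)

lemma matrix_sum_ldistrib: "A ** (\<Sum>i\<in>S. f i) = (\<Sum>i\<in>S. A ** (f i :: 'a::semiring_1 ^ 'p ^ 'n))"
  by (induction S rule: infinite_finite_induct) (auto simp: matrix_add_ldistrib)

lemma matrix_sum_mult_vec: "(\<Sum>i\<in>S. f i) *v x = (\<Sum>i\<in>S. (f i :: 'a::semiring_1 ^ 'p ^ 'n) *v x)"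
  by (induction S rule: infinite_finite_induct) (auto simp: matrix_vector_mult_add_rdistrib)

lemma scaleR_mult_vec: "(r *\<^sub>R A) *v x = r *\<^sub>R ((A :: 'a::real_algebra_1 ^ 'p ^ 'n) *v x)"
  by (simp add: matrix_vector_mult_def vec_eq_iff scaleR_sum_right)

lemma of_real_vector_scale: "complex_of_real r *s x = r *\<^sub>R x"
  by (simp add: vec_eq_iff scaleR_conv_of_real[where 'a=complex])

lemma trace_scaleR: "trace (r *\<^sub>R (A :: 'a::real_algebra_1 ^ 'n ^ 'n)) = r *\<^sub>R trace A"
  by (simp add: trace_def scaleR_sum_right)

lemma trace_sum: "trace (\<Sum>i\<in>S. f i) = (\<Sum>i\<in>S. trace (f i :: 'a::comm_semiring_1 ^ 'n ^ 'n))"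
  by (induction S rule: infinite_finite_induct) (auto simp: trace_add trace_0[unfolded mat_0])

lemma inner_eq_Re_trace: "A \<bullet> B = Re (trace (cadjoint A ** B))"
proof -
  have "Re (trace (cadjoint A ** B)) = (\<Sum>i\<in>UNIV. \<Sum>k\<in>UNIV. A $ k $ i \<bullet> B $ k $ i)"
    by (simp add: trace_def matrix_matrix_mult_def cadjoint_def inner_complex_def)
  also have "\<dots> = (\<Sum>k\<in>UNIV. \<Sum>i\<in>UNIV. A $ k $ i \<bullet> B $ k $ i)"
    by (rule sum.swap)
  finally show ?thesis
    by (simp add: inner_vec_def)
qed

lemma trace_mult_rank_one_proj: "trace (A ** rank_one_proj v) = cinner v (A *v v)"
  by (simp add: trace_def matrix_matrix_mult_def rank_one_proj_def cinner_def matrix_vector_mult_def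
      sum_distrib_left mult_ac)

section \<open>Orthonormal families\<close>

text \<open>The index set is a parameter so that an eigenbasis can be built one vector at a time; on
  \<open>UNIV\<close> the condition is the one in \<open>rank_one_pvm\<close>.\<close>

definition orthonormal_on :: "'a set \<Rightarrow> ('a \<Rightarrow> complex ^ 'n) \<Rightarrow> bool" where
  "orthonormal_on S v \<longleftrightarrow> (\<forall>j\<in>S. \<forall>k\<in>S. cinner (v j) (v k) = (if j = k then 1 else 0))"

lemma orthonormal_norm: "orthonormal_on S v \<Longrightarrow> j \<in> S \<Longrightarrow> norm (v j) = 1"
proof -
  assume "orthonormal_on S v" "j \<in> S"
  then have "Re (cinner (v j) (v j)) = 1"
    by (simp add: orthonormal_on_def)
  then show "norm (v j) = 1"
    by (simp add: norm_eq_1 flip: inner_eq_Re_cinner)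
qed

text \<open>The vectors are the columns of a square matrix \<open>V\<close>. Orthonormality makes
  \<open>cadjoint V\<close> a left inverse, hence a right inverse, and
  \<open>V ** cadjoint V\<close> is the sum of the projections.\<close>

lemma orthonormal_resolution:
  fixes v :: "'n \<Rightarrow> complex ^ 'n"
  assumes "orthonormal_on UNIV v"
  shows "(\<Sum>j\<in>UNIV. rank_one_proj (v j)) = mat 1"
proof -
  define V :: "complex ^ 'n ^ 'n" where "V = (\<chi> i j. v j $ i)"
  have "cadjoint V ** V = mat 1"
    using assms
    by (simp add: V_def vec_eq_iff matrix_matrix_mult_def cadjoint_def mat_def orthonormal_on_def cinner_def)
  then have "V ** cadjoint V = mat 1"
    using matrix_left_right_inverse by blast
  moreover have "V ** cadjoint V = (\<Sum>j\<in>UNIV. rank_one_proj (v j))"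
    by (simp add: V_def vec_eq_iff matrix_matrix_mult_def cadjoint_def rank_one_proj_def)
  ultimately show ?thesis by simp
qed

lemma orthonormal_expansion:
  assumes "orthonormal_on UNIV (v :: 'n \<Rightarrow> complex ^ 'n)"
  shows "(\<Sum>j\<in>UNIV. cinner (v j) x *s v j) = x"
  using arg_cong[OF orthonormal_resolution[OF assms], of "\<lambda>A. A *v x"]
  by (simp add: matrix_sum_mult_vec rank_one_proj_mult_vec)

lemma parseval:
  assumes "orthonormal_on UNIV (v :: 'n \<Rightarrow> complex ^ 'n)"
  shows "(norm x)\<^sup>2 = (\<Sum>j\<in>UNIV. (cmod (cinner (v j) x))\<^sup>2)"
proof -
  have "cinner x x = (\<Sum>j\<in>UNIV. cinner (v j) x * cinner x (v j))"
    by (subst (2) orthonormal_expansion[OF assms, symmetric]) (simp add: cinner_sum_right cinner_scale_right)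
  also have "\<dots> = (\<Sum>j\<in>UNIV. of_real ((cmod (cinner (v j) x))\<^sup>2))"
    by (rule sum.cong) (metis cnj_cinner complex_norm_square)+
  finally show ?thesis
    unfolding cinner_self by (metis of_real_eq_iff of_real_sum)
qed

lemma trace_orthonormal:
  assumes "orthonormal_on UNIV (v :: 'n \<Rightarrow> complex ^ 'n)"
  shows "trace A = (\<Sum>j\<in>UNIV. cinner (v j) (A *v v j))"
proof -
  have "trace A = trace (A ** (\<Sum>j\<in>UNIV. rank_one_proj (v j)))"
    by (simp add: orthonormal_resolution[OF assms])
  then show ?thesis
    by (simp add: matrix_sum_ldistrib trace_sum trace_mult_rank_one_proj)
qed

lemma inner_orthonormal:
  fixes A B :: "complex ^ 'n ^ 'n"
  assumes "orthonormal_on UNIV (v :: 'n \<Rightarrow> complex ^ 'n)"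
  shows "A \<bullet> B = (\<Sum>j\<in>UNIV. (A *v v j) \<bullet> (B *v v j))"
proof -
  have "cinner (v j) ((cadjoint A ** B) *v v j) = cinner (A *v v j) (B *v v j)" for j
    by (metis cadjoint_cadjoint cinner_adjoint_left matrix_vector_mul_assoc)
  then show ?thesis
    by (simp add: inner_eq_Re_trace trace_orthonormal[OF assms] inner_eq_Re_cinner)
qed

lemma norm_orthonormal:
  fixes A :: "complex ^ 'n ^ 'n"
  assumes "orthonormal_on UNIV (v :: 'n \<Rightarrow> complex ^ 'n)"
  shows "(norm A)\<^sup>2 = (\<Sum>k\<in>UNIV. (norm (A *v v k))\<^sup>2)"
  by (simp only: power2_norm_eq_inner inner_orthonormal[OF assms])

lemma norm_cadjoint: "norm (cadjoint A) = norm A"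
proof -
  have "cadjoint A \<bullet> cadjoint A = A \<bullet> A"
    by (metis cadjoint_cadjoint inner_eq_Re_trace trace_mul_sym)
  then show ?thesis by (simp add: norm_eq_sqrt_inner)
qed

section \<open>The spectral theorem\<close>

text \<open>A maximizer of the Rayleigh quotient on the unit sphere of the invariant subspace
  \<open>K\<close> is an eigenvector. The real inner product suffices, because complex vectors form
  a real Euclidean space and Hermitian matrices act on it self-adjointly.\<close>

lemma self_adjoint_eigenvector:
  fixes f :: "'a::euclidean_space \<Rightarrow> 'a"
  assumes f: "linear f" and sa: "\<And>x y. f x \<bullet> y = x \<bullet> f y"
    and K: "subspace K" and fK: "\<And>x. x \<in> K \<Longrightarrow> f x \<in> K" and x: "x \<in> K" "x \<noteq> 0"
  obtains u m where "u \<in> K" "norm u = 1" "f u = m *\<^sub>R u"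
proof -
  interpret f: linear f by (rule f)
  let ?S = "sphere 0 1 \<inter> K"
  have "compact ?S"
    by (simp add: closed_subspace compact_Int_closed K)
  moreover have "x /\<^sub>R norm x \<in> ?S"
    using x K by (simp add: subspace_scale)
  then have "?S \<noteq> {}" by blast
  moreover have "continuous_on ?S (\<lambda>y. y \<bullet> f y)"
    by (intro continuous_intros linear_continuous_on linear_conv_bounded_linear[THEN iffD1] f)
  ultimately obtain u where u: "u \<in> ?S" and max: "\<And>y. y \<in> ?S \<Longrightarrow> y \<bullet> f y \<le> u \<bullet> f u"
    using continuous_attains_sup[of ?S "\<lambda>y. y \<bullet> f y"] by blast
  define m where "m = u \<bullet> f u"
  define g where "g y = m *\<^sub>R y - f y" for y
  define h where "h = g u"
  \<comment> \<open>By scaling, maximality on the sphere says that \<open>g = m - f\<close> has a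
    nonnegative quadratic form on all of \<open>K\<close>. The goal becomes
    \<open>h = g u = 0\<close>.\<close>
  have nonneg: "0 \<le> y \<bullet> g y" if "y \<in> K" for y
  proof (cases "y = 0")
    case False
    then have "(y /\<^sub>R norm y) \<bullet> f (y /\<^sub>R norm y) \<le> m"
      using that K unfolding m_def by (intro max) (simp add: subspace_scale)
    then have "y \<bullet> f y \<le> m * (norm y)\<^sup>2"
      using False by (simp add: f.scaleR field_simps power2_eq_square)
    then show ?thesis
      by (simp add: g_def inner_diff_right power2_norm_eq_inner)
  qed (simp add: g_def)
  have uK: "u \<in> K" and nu: "norm u = 1" using u by auto
  have hK: "h \<in> K"
    using uK K fK by (simp add: h_def g_def subspace_diff subspace_scale)
  have ug: "u \<bullet> h = 0"
    using nu by (simp add: h_def g_def m_def inner_diff_right norm_eq_1)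
  have ugh: "u \<bullet> g h = h \<bullet> h"
    by (simp add: h_def g_def inner_diff_right inner_diff_left f.diff f.scaleR sa inner_commute)
      (simp add: algebra_simps inner_commute sa)
  have quad: "2 * \<epsilon> * (h \<bullet> h) \<le> \<epsilon>\<^sup>2 * (h \<bullet> g h)" for \<epsilon>
  proof -
    have g_lin: "g (u - \<epsilon> *\<^sub>R h) = g u - \<epsilon> *\<^sub>R g h"
      by (simp add: g_def f.diff f.scaleR algebra_simps)
    have "0 \<le> (u - \<epsilon> *\<^sub>R h) \<bullet> g (u - \<epsilon> *\<^sub>R h)"
      using uK hK K by (intro nonneg) (simp add: subspace_diff subspace_scale)
    also have "\<dots> = u \<bullet> g u - \<epsilon> * (u \<bullet> g h) - \<epsilon> * (h \<bullet> g u) + \<epsilon>\<^sup>2 * (h \<bullet> g h)"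
      by (simp add: g_lin inner_diff_left inner_diff_right power2_eq_square algebra_simps)
    finally show ?thesis
      by (simp add: ug ugh flip: h_def)
  qed
  \<comment> \<open>Maximality of \<open>u\<close> makes the first-order term of \<open>\<epsilon> \<mapsto> (u - \<epsilon> h) \<bullet> g (u - \<epsilon> h)\<close> vanish.\<close>
  have "h \<bullet> h = 0"
  proof (rule ccontr)
    assume "h \<bullet> h \<noteq> 0"
    then have pos: "0 < h \<bullet> h" by simp
    \<comment> \<open>With this choice the second-order term is at most half of the first-order one;
      the added 1 keeps the denominator positive.\<close>
    define \<epsilon> where "\<epsilon> = (h \<bullet> h) / (\<bar>h \<bullet> g h\<bar> + 1)"
    have \<epsilon>: "0 < \<epsilon>" using pos by (simp add: \<epsilon>_def add_nonneg_pos)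
    have "2 * (h \<bullet> h) \<le> \<epsilon> * (h \<bullet> g h)"
      using quad[of \<epsilon>] \<epsilon> by (simp add: power2_eq_square mult.assoc)
    also have "\<dots> \<le> \<epsilon> * (\<bar>h \<bullet> g h\<bar> + 1)"
      using \<epsilon> by (intro mult_left_mono) auto
    also have "\<dots> = h \<bullet> h"
      by (simp add: \<epsilon>_def)
    finally show False using pos by simp
  qed
  then have "f u = m *\<^sub>R u"
    by (simp add: h_def g_def)
  with uK nu that show thesis by blast
qed

text \<open>Induction on the set of labels: the orthogonal complement of the eigenvectors found so
  far is invariant under \<open>A\<close>, so it contains a further eigenvector as long as it is
  nonzero.\<close>

lemma hermitian_orthonormal_eigenvectors:
  fixes A :: "complex ^ 'n ^ 'n" and S :: "'n set"
  assumes A: "hermitian A"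
  shows "\<exists>w \<mu>. orthonormal_on S w \<and> (\<forall>j\<in>S. A *v w j = complex_of_real (\<mu> j) *s w j)"
proof (induction S rule: finite_induct[OF finite])
  case 1
  then show ?case by (simp add: orthonormal_on_def)
next
  case (2 j S)
  then obtain w \<mu> where w: "orthonormal_on S w"
    and ew: "\<And>k. k \<in> S \<Longrightarrow> A *v w k = complex_of_real (\<mu> k) *s w k"
    by blast
  let ?K = "{x. \<forall>k\<in>S. cinner (w k) x = 0}"
  \<comment> \<open>If the complement were zero, the projections labelled by \<open>S\<close> would
    already sum to the identity. Taking traces gives \<open>card S = CARD('n)\<close>, although
    \<open>j\<close> lies outside \<open>S\<close>.\<close>
  have "\<exists>x\<in>?K. x \<noteq> 0"
  proof (rule ccontr)
    assume no: "\<not> ?thesis"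
    have "(\<Sum>k\<in>S. rank_one_proj (w k)) *v x = mat 1 *v x" for x
    proof -
      have "x - (\<Sum>k\<in>S. cinner (w k) x *s w k) \<in> ?K"
      proof (intro CollectI ballI)
        fix k assume k: "k \<in> S"
        have "(\<Sum>l\<in>S. cinner (w l) x * cinner (w k) (w l)) = (\<Sum>l\<in>S. if k = l then cinner (w l) x else 0)"
          using w k by (intro sum.cong) (auto simp: orthonormal_on_def)
        then show "cinner (w k) (x - (\<Sum>l\<in>S. cinner (w l) x *s w l)) = 0"
          using k 2 by (simp add: cinner_diff_right cinner_sum_right cinner_scale_right)
      qed
      then have "x - (\<Sum>k\<in>S. cinner (w k) x *s w k) = 0"
        using no by blast
      then show ?thesis
        by (simp add: matrix_sum_mult_vec rank_one_proj_mult_vec)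
    qed
    then have "(\<Sum>k\<in>S. rank_one_proj (w k)) = mat 1"
      by (simp add: matrix_eq)
    then have "trace (mat 1 :: complex ^ 'n ^ 'n) = (\<Sum>k\<in>S. trace (mat 1 ** rank_one_proj (w k)))"
      by (metis (no_types, lifting) matrix_mul_lid sum.cong trace_sum)
    also have "\<dots> = of_nat (card S)"
      using w by (simp add: trace_mult_rank_one_proj orthonormal_on_def del: matrix_mul_lid)
    finally have "card S = CARD('n)"
      by (simp add: trace_I)
    then show False
      using 2 by (metis UNIV_I card_subset_eq finite subset_UNIV)
  qed
  then obtain x where x: "x \<in> ?K" "x \<noteq> 0" by blast
  have K: "subspace ?K"
    by (auto simp: subspace_def cinner_add_right cinner_scaleR_right)
      (simp add: cinner_def)
  have AK: "A *v y \<in> ?K" if "y \<in> ?K" for y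
  proof -
    have "cinner (w k) (A *v y) = cnj (cinner y (A *v w k))" if "k \<in> S" for k
      by (simp add: cnj_cinner cinner_hermitian[OF A])
    moreover have "cinner y (w k) = 0" if "k \<in> S" for k
      using \<open>y \<in> ?K\<close> that cnj_cinner[of "w k" y] by auto
    ultimately show ?thesis
      by (auto simp: ew cinner_scale_right)
  qed
  \<comment> \<open>Here \<open>?K\<close> is regarded as a real subspace with inner product
    \<open>Re (cinner x y)\<close>; this also yields a real eigenvalue \<open>m\<close>.\<close>
  obtain u m where u: "u \<in> ?K" "norm u = 1" "A *v u = m *\<^sub>R u"
    by (rule self_adjoint_eigenvector[where f = "(*v) A" and K = ?K and x = x])
      (use K x AK in \<open>simp_all add: inner_eq_Re_cinner cinner_hermitian[OF A]\<close>)
  have "cinner u (w k) = 0" if "k \<in> S" for k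
    using u(1) that cnj_cinner[of "w k" u] by auto
  moreover have uu: "cinner u u = 1"
    using u by (simp add: cinner_self)
  ultimately have "orthonormal_on (insert j S) (w(j := u))"
    using w u 2 by (auto simp: orthonormal_on_def)
  moreover have "\<forall>k\<in>insert j S. A *v (w(j := u)) k = complex_of_real ((\<mu>(j := m)) k) *s (w(j := u)) k"
    using ew u 2 by (auto simp: of_real_vector_scale)
  ultimately show ?case by blast
qed

lemma hermitian_eigenbasis:
  assumes "hermitian (A :: complex ^ 'n ^ 'n)"
  obtains w :: "'n \<Rightarrow> complex ^ 'n" and \<mu>
  where "orthonormal_on UNIV w" "\<And>j. A *v w j = complex_of_real (\<mu> j) *s w j"
proof -
  have "\<exists>(w :: 'n \<Rightarrow> complex ^ 'n) \<mu>. orthonormal_on UNIV w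
      \<and> (\<forall>j\<in>UNIV. A *v w j = complex_of_real (\<mu> j) *s w j)"
    by (rule hermitian_orthonormal_eigenvectors[OF assms])
  then show thesis
    by (elim exE conjE) (rule that, auto)
qed

lemma cinner_eigenvector_left:
  assumes "hermitian A" and "A *v w = complex_of_real m *s w"
  shows "cinner w (A *v x) = of_real m * cinner w x"
proof -
  have "cinner w (A *v x) = cnj (cinner x (A *v w))"
    by (simp add: cnj_cinner cinner_hermitian[OF assms(1)])
  then show ?thesis
    by (simp add: assms(2) cinner_scale_right cnj_cinner)
qed

section \<open>The smallest eigenvalue and positivity of traces\<close>

lemma
  fixes A :: "complex ^ 'n ^ 'n"
  assumes A: "pos_def A"
  shows lambda_min_pos: "0 < lambda_min A"
    and lambda_min_le: "lambda_min A * (norm x)\<^sup>2 \<le> x \<bullet> (A *v x)"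
proof -
  have h: "hermitian A" using A by (simp add: pos_def_def)
  obtain w :: "'n \<Rightarrow> complex ^ 'n" and s where w: "orthonormal_on UNIV w"
    and ew: "\<And>j. A *v w j = complex_of_real (s j) *s w j"
    using hermitian_eigenbasis[OF h] by blast
  have nz: "w j \<noteq> 0" for j
    using orthonormal_norm[OF w, of j] by auto
  \<comment> \<open>This identifies the set under \<open>Min\<close> as finite and nonempty. An
    eigenvector \<open>y\<close> has a nonzero coefficient along some \<open>w j\<close>, and
    comparing that coefficient in \<open>A *v y\<close> forces its eigenvalue to be
    \<open>s j\<close>.\<close>
  have spec: "{r. eigenvalue A (complex_of_real r)} = range s"
  proof (intro subset_antisym subsetI)
    fix r assume "r \<in> {r. eigenvalue A (complex_of_real r)}"
    then obtain y where y: "y \<noteq> 0" "A *v y = complex_of_real r *s y"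
      by (auto simp: eigenvalue_def)
    have "(norm y)\<^sup>2 \<noteq> 0" using y by simp
    then obtain j where "cinner (w j) y \<noteq> 0"
      unfolding parseval[OF w] by (metis (no_types, lifting) norm_zero sum.neutral zero_power2)
    moreover have "of_real (s j) * cinner (w j) y = of_real r * cinner (w j) y"
      using cinner_eigenvector_left[OF h ew] y(2) cinner_scale_right by metis
    ultimately show "r \<in> range s" by auto
  qed (use ew nz in \<open>auto simp: eigenvalue_def\<close>)
  have min_le: "lambda_min A \<le> s j" for j
    by (simp add: lambda_min_def spec)
  have "lambda_min A \<in> range s"
    unfolding lambda_min_def spec by (rule Min_in) auto
  then obtain j where j: "lambda_min A = s j" by auto
  have "0 < Re (cinner (w j) (A *v w j))"
    using A nz by (simp add: pos_def_def)
  then show "0 < lambda_min A"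
    using w by (simp add: ew j cinner_scale_right orthonormal_on_def)
  have "cinner x (A *v x) = (\<Sum>j\<in>UNIV. cinner (w j) (A *v x) * cinner x (w j))"
    by (subst orthonormal_expansion[OF w, of "A *v x", symmetric]) (simp add: cinner_sum_right cinner_scale_right)
  also have "\<dots> = (\<Sum>j\<in>UNIV. of_real (s j * (cmod (cinner (w j) x))\<^sup>2))"
  proof (rule sum.cong)
    fix j
    have "cinner (w j) x * cinner x (w j) = of_real ((cmod (cinner (w j) x))\<^sup>2)"
      by (metis cnj_cinner complex_norm_square)
    then show "cinner (w j) (A *v x) * cinner x (w j) = of_real (s j * (cmod (cinner (w j) x))\<^sup>2)"
      by (simp add: cinner_eigenvector_left[OF h ew])
  qed simp
  finally have "x \<bullet> (A *v x) = (\<Sum>j\<in>UNIV. s j * (cmod (cinner (w j) x))\<^sup>2)"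
    by (simp add: inner_eq_Re_cinner)
  then show "lambda_min A * (norm x)\<^sup>2 \<le> x \<bullet> (A *v x)"
    by (simp add: parseval[OF w] sum_distrib_left sum_mono mult_right_mono min_le)
qed

text \<open>In an eigenbasis of \<open>B\<close> the trace is a sum of eigenvalues of
  \<open>B\<close> times values of the quadratic form of \<open>A\<close>, all nonnegative.\<close>

lemma trace_mult_nonneg:
  fixes A B :: "complex ^ 'n ^ 'n"
  assumes A: "pos_semidef A" and B: "pos_semidef B"
  shows "0 \<le> Re (trace (A ** B))"
proof -
  have h: "hermitian B" using B by (simp add: pos_semidef_def)
  obtain w :: "'n \<Rightarrow> complex ^ 'n" and s where w: "orthonormal_on UNIV w"
    and ew: "\<And>j. B *v w j = complex_of_real (s j) *s w j"
    using hermitian_eigenbasis[OF h] by blast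
  have s: "0 \<le> s j" for j
  proof -
    have "0 \<le> Re (cinner (w j) (B *v w j))"
      using B by (simp add: pos_semidef_def)
    then show ?thesis
      using w by (simp add: ew cinner_scale_right orthonormal_on_def)
  qed
  have "trace (A ** B) = (\<Sum>j\<in>UNIV. of_real (s j) * cinner (w j) (A *v w j))"
    by (simp add: trace_orthonormal[OF w] ew vector_scalar_commute cinner_scale_right
        flip: matrix_vector_mul_assoc)
  then show ?thesis
    using A s by (simp add: pos_semidef_def sum_nonneg)
qed

lemma pos_semidef_congruence:
  assumes "pos_semidef A"
  shows "pos_semidef (cadjoint B ** A ** B)"
proof -
  have "cinner x ((cadjoint B ** A ** B) *v x) = cinner (B *v x) (A *v (B *v x))" for x
    by (metis cadjoint_cadjoint cinner_adjoint_left matrix_vector_mul_assoc)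
  with assms show ?thesis
    by (simp add: pos_semidef_def hermitian_def cadjoint_mult matrix_mul_assoc)
qed

section \<open>The Lyapunov equation\<close>

text \<open>Each of the two products contributes \<open>lambda_min A * (norm X)\<^sup>2\<close>. For
  \<open>A ** X\<close> this is seen vector by vector along an orthonormal basis;
  \<open>X ** A\<close> reduces to it by passing to \<open>cadjoint X\<close> and using cyclicity of
  the trace.\<close>

lemma lyapunov_coercive:
  fixes A X :: "complex ^ 'n ^ 'n"
  assumes A: "pos_def A"
  shows "2 * lambda_min A * (norm X)\<^sup>2 \<le> X \<bullet> (A ** X + X ** A)"
proof -
  have "hermitian A" using A by (simp add: pos_def_def)
  then obtain w :: "'n \<Rightarrow> complex ^ 'n" and s where w: "orthonormal_on UNIV w"
    using hermitian_eigenbasis by blast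
  have left: "lambda_min A * (norm Y)\<^sup>2 \<le> Y \<bullet> (A ** Y)" for Y :: "complex ^ 'n ^ 'n"
    using lambda_min_le[OF A]
    by (simp add: norm_orthonormal[OF w] inner_orthonormal[OF w] sum_distrib_left sum_mono
        flip: matrix_vector_mul_assoc)
  have "X \<bullet> (X ** A) = cadjoint X \<bullet> (A ** cadjoint X)"
    unfolding inner_eq_Re_trace cadjoint_cadjoint matrix_mul_assoc
    by (metis matrix_mul_assoc trace_mul_sym)
  with left[of X] left[of "cadjoint X"] show ?thesis
    by (simp add: norm_cadjoint inner_add_right)
qed

text \<open>Coercivity and Cauchy-Schwarz, with one factor \<open>norm X\<close> cancelled. It
  serves twice: for injectivity of the Lyapunov map and for the size of
  \<open>\<Lambda> - \<Gamma>\<close>.\<close>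

lemma lyapunov_norm_le:
  fixes A X :: "complex ^ 'n ^ 'n"
  assumes A: "pos_def A"
  shows "2 * lambda_min A * norm X \<le> norm (A ** X + X ** A)"
proof (cases "X = 0")
  case False
  have "2 * lambda_min A * (norm X)\<^sup>2 \<le> norm X * norm (A ** X + X ** A)"
    using lyapunov_coercive[OF A] norm_cauchy_schwarz order_trans by blast
  then have "norm X * (2 * lambda_min A * norm X) \<le> norm X * norm (A ** X + X ** A)"
    by (simp add: power2_eq_square mult_ac)
  then show ?thesis
    using False by simp
qed simp

text \<open>The Lyapunov map is an injective real-linear endomorphism of a finite-dimensional space,
  hence surjective. It commutes with the adjoint, so injectivity forces the solution for Hermitian
  \<open>R\<close> to be Hermitian.\<close>

lemma lyapunov_hermitian_solution:
  fixes A R :: "complex ^ 'n ^ 'n"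
  assumes A: "pos_def A" and R: "hermitian R"
  obtains X where "A ** X + X ** A = R" and "hermitian X"
proof -
  define L where "L X = A ** X + X ** A" for X :: "complex ^ 'n ^ 'n"
  have hA: "cadjoint A = A" using A by (simp add: pos_def_def hermitian_def)
  have lin: "linear L"
    by (rule linearI)
      (simp_all add: L_def matrix_add_ldistrib matrix_add_rdistrib matrix_scalar_ac
        scaleR_right_distrib flip: scalar_matrix_assoc)
  have "X = 0" if "L X = 0" for X
  proof -
    have "2 * lambda_min A * norm X \<le> 0"
      using lyapunov_norm_le[OF A, of X] that by (simp add: L_def)
    then show ?thesis
      using lambda_min_pos[OF A] by (simp add: mult_le_0_iff)
  qed
  then have inj: "inj L"
    using lin by (simp add: linear_injective_0)
  then have "surj L"
    using lin linear_injective_imp_surjective by blast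
  then obtain X where X: "L X = R" by (metis surjD)
  have "L (cadjoint X) = cadjoint (L X)"
    by (simp add: L_def cadjoint_add cadjoint_mult hA add.commute)
  then have "L (cadjoint X) = L X"
    using R X by (simp add: hermitian_def)
  then have "hermitian X"
    using inj by (simp add: hermitian_def injD)
  with X that show thesis by (auto simp: L_def)
qed

section \<open>Optimality of the eigenbasis of the Lyapunov solution\<close>

text \<open>
  With \<open>u = (p - q) / q\<close> the term is \<open>2 u (p - q) - u\<^sup>2 q\<close>, also for \<open>q = 0\<close>, where both vanish because of
  \<open>x / 0 = 0\<close>. The claim is then that \<open>(u - Z) \<sigma> (u - Z)\<close> has nonnegative trace against \<open>M\<close>.
\<close>

lemma outcome_term_le:
  fixes \<rho> \<sigma> Z M :: "complex ^ 'n ^ 'n"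
  assumes \<sigma>: "pos_semidef \<sigma>" and Z: "hermitian Z" and M: "pos_semidef M"
    and lyap: "\<sigma> ** Z + Z ** \<sigma> = 2 *\<^sub>R (\<rho> - \<sigma>)"
  shows "outcome_prob \<sigma> M * h1 (outcome_prob \<rho> M / outcome_prob \<sigma> M) \<le> Re (trace (Z ** \<sigma> ** Z ** M))"
proof -
  define p q where "p = outcome_prob \<rho> M" and "q = outcome_prob \<sigma> M"
  define u where "u = (p - q) / q"
  define B where "B = u *\<^sub>R mat 1 - Z"
  have adjB: "cadjoint B = B"
    using Z by (simp add: B_def cadjoint_diff cadjoint_scaleR hermitian_def)
  have "0 \<le> Re (trace ((cadjoint B ** \<sigma> ** B) ** M))"
    by (intro trace_mult_nonneg pos_semidef_congruence \<sigma> M)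
  also have "cadjoint B ** \<sigma> ** B = u\<^sup>2 *\<^sub>R \<sigma> - u *\<^sub>R (\<sigma> ** Z + Z ** \<sigma>) + Z ** \<sigma> ** Z"
    unfolding adjB
    by (simp add: B_def matrix_diff_ldistrib matrix_diff_rdistrib matrix_scalar_ac power2_eq_square
        algebra_simps flip: scalar_matrix_assoc)
  also have "Re (trace (\<dots> ** M)) = u\<^sup>2 * q - 2 * u * (p - q) + Re (trace (Z ** \<sigma> ** Z ** M))"
    unfolding lyap
    by (simp add: matrix_add_rdistrib matrix_diff_rdistrib trace_add trace_sub trace_scaleR
        p_def q_def outcome_prob_def algebra_simps flip: scalar_matrix_assoc)
  finally have "2 * u * (p - q) - u\<^sup>2 * q \<le> Re (trace (Z ** \<sigma> ** Z ** M))"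
    by simp
  moreover have "q * h1 (p / q) = 2 * u * (p - q) - u\<^sup>2 * q"
    by (cases "q = 0") (simp_all add: u_def h1_def field_simps power2_eq_square)
  ultimately show ?thesis
    by (simp add: p_def q_def)
qed

text \<open>The equality case of \<open>outcome_term_le\<close>: sandwiching the Lyapunov equation
  between \<open>w\<close> gives \<open>p - q = z * q\<close>, so both sides equal
  \<open>z\<^sup>2 * q\<close>, including the case \<open>q = 0\<close>.\<close>

lemma outcome_term_eigenvector:
  fixes \<rho> \<sigma> Z :: "complex ^ 'n ^ 'n"
  assumes Z: "hermitian Z" and w: "Z *v w = complex_of_real z *s w"
    and lyap: "\<sigma> ** Z + Z ** \<sigma> = 2 *\<^sub>R (\<rho> - \<sigma>)"
  defines "M \<equiv> rank_one_proj w"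
  shows "outcome_prob \<sigma> M * h1 (outcome_prob \<rho> M / outcome_prob \<sigma> M) = Re (trace (Z ** \<sigma> ** Z ** M))"
proof -
  define p q where "p = outcome_prob \<rho> M" and "q = outcome_prob \<sigma> M"
  have p: "p = Re (cinner w (\<rho> *v w))" and q: "q = Re (cinner w (\<sigma> *v w))"
    by (simp_all add: p_def q_def M_def outcome_prob_def trace_mult_rank_one_proj)
  have "cinner w ((\<sigma> ** Z + Z ** \<sigma>) *v w) = 2 * of_real z * cinner w (\<sigma> *v w)"
    by (simp add: matrix_vector_mult_add_rdistrib cinner_add_right w vector_scalar_commute
        cinner_scale_right cinner_eigenvector_left[OF Z w] flip: matrix_vector_mul_assoc)
  moreover have "Re (cinner w ((\<sigma> ** Z + Z ** \<sigma>) *v w)) = 2 * (p - q)"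
    by (simp add: lyap scaleR_mult_vec cinner_scaleR_right matrix_vector_mult_diff_rdistrib
        cinner_diff_right p q)
  ultimately have "p - q = z * q"
    by (simp add: q)
  then have "q * h1 (p / q) = z\<^sup>2 * q"
    by (cases "q = 0") (simp_all add: h1_def field_simps power2_eq_square)
  moreover have "Re (trace (Z ** \<sigma> ** Z ** M)) = z\<^sup>2 * q"
    by (simp add: M_def trace_mult_rank_one_proj w vector_scalar_commute cinner_scale_right
        cinner_eigenvector_left[OF Z w] q power2_eq_square flip: matrix_vector_mul_assoc)
  ultimately show ?thesis
    by (simp add: p_def q_def)
qed

text \<open>Summing the outcome bounds and using completeness gives
  \<open>Re (trace (Z ** \<sigma> ** Z))\<close>, the same for every POVM; an eigenbasis turns every
  outcome bound into an equality.\<close>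

lemma eigenbasis_optimal:
  fixes \<rho> \<sigma> \<Lambda> :: "complex ^ 'n ^ 'n" and w :: "'n \<Rightarrow> complex ^ 'n"
  assumes \<sigma>: "pos_semidef \<sigma>" and \<Lambda>: "hermitian \<Lambda>"
    and lyap: "\<sigma> ** \<Lambda> + \<Lambda> ** \<sigma> = 2 *\<^sub>R \<rho>"
    and w: "orthonormal_on UNIV w" and ew: "\<And>j. \<Lambda> *v w j = complex_of_real (\<mu> j) *s w j"
  shows "ereal (pvm_div h1 \<rho> \<sigma> (\<lambda>j. rank_one_proj (w j))) = measured_div h1 \<rho> \<sigma>"
proof -
  define Q where "Q j = rank_one_proj (w j)" for j
  \<comment> \<open>The shift matches the centre 1 of \<open>h1\<close> and changes the right-hand
    side of the Lyapunov equation from \<open>\<rho>\<close> to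
    \<open>\<rho> - \<sigma>\<close>.\<close>
  define Z where "Z = \<Lambda> - mat 1"
  have Z: "hermitian Z"
    using \<Lambda> by (simp add: Z_def hermitian_def cadjoint_diff)
  have eZ: "Z *v w j = complex_of_real (\<mu> j - 1) *s w j" for j
    by (simp add: Z_def matrix_vector_mult_diff_rdistrib ew vector_sub_rdistrib)
  have lyapZ: "\<sigma> ** Z + Z ** \<sigma> = 2 *\<^sub>R (\<rho> - \<sigma>)"
    using lyap by (simp add: Z_def matrix_diff_ldistrib matrix_diff_rdistrib scaleR_2 algebra_simps)
  have sumQ: "(\<Sum>j\<in>UNIV. Q j) = mat 1"
    unfolding Q_def by (rule orthonormal_resolution[OF w])
  have upper: "outcome_div h1 \<rho> \<sigma> {..<m} M \<le> Re (trace (Z ** \<sigma> ** Z))" if "povm m M" for m M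
  proof -
    have "outcome_div h1 \<rho> \<sigma> {..<m} M \<le> (\<Sum>y<m. Re (trace (Z ** \<sigma> ** Z ** M y)))"
      unfolding outcome_div_def
      using that by (intro sum_mono outcome_term_le \<sigma> Z lyapZ) (simp add: povm_def)
    also have "\<dots> = Re (trace (Z ** \<sigma> ** Z ** (\<Sum>y<m. M y)))"
      by (simp add: matrix_sum_ldistrib trace_sum)
    finally show ?thesis
      using that by (simp add: povm_def)
  qed
  have "pvm_div h1 \<rho> \<sigma> Q = (\<Sum>j\<in>UNIV. Re (trace (Z ** \<sigma> ** Z ** Q j)))"
    unfolding pvm_div_def outcome_div_def Q_def
    by (intro sum.cong refl outcome_term_eigenvector[OF Z eZ lyapZ])
  also have "\<dots> = Re (trace (Z ** \<sigma> ** Z ** (\<Sum>j\<in>UNIV. Q j)))"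
    by (simp add: matrix_sum_ldistrib trace_sum)
  finally have attained: "pvm_div h1 \<rho> \<sigma> Q = Re (trace (Z ** \<sigma> ** Z))"
    by (simp add: sumQ)
  \<comment> \<open>POVMs are indexed by an initial segment of the naturals, so the PVM must be
    relabelled before it counts as a competitor in the supremum.\<close>
  obtain e where e: "bij_betw e {..<CARD('n)} (UNIV :: 'n set)"
    using ex_bij_betw_nat_finite[of "UNIV :: 'n set"] by (auto simp: lessThan_atLeast0)
  have "povm CARD('n) (Q \<circ> e)"
    using sum.reindex_bij_betw[OF e, of Q]
    by (simp add: povm_def sumQ) (simp add: Q_def pos_semidef_rank_one_proj)
  moreover have "outcome_div h1 \<rho> \<sigma> {..<CARD('n)} (Q \<circ> e) = pvm_div h1 \<rho> \<sigma> Q"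
    unfolding pvm_div_def outcome_div_def comp_def by (rule sum.reindex_bij_betw[OF e])
  ultimately have "ereal (pvm_div h1 \<rho> \<sigma> Q) \<in> {ereal (outcome_div h1 \<rho> \<sigma> {..<m} M) | m M. povm m M}"
    by (metis (mono_tags, lifting) mem_Collect_eq)
  then have "measured_div h1 \<rho> \<sigma> = ereal (pvm_div h1 \<rho> \<sigma> Q)"
    unfolding measured_div_def
    by (intro Sup_eqI) (use upper in \<open>auto simp flip: attained\<close>)
  then show ?thesis
    by (simp add: Q_def[abs_def])
qed

section \<open>Perturbation of eigenbases\<close>

text \<open>
  Each eigenvalue \<open>\<mu> i\<close> of \<open>\<Lambda>\<close> is matched with a nearest \<open>t\<close>; all the others are then at distance at
  least \<open>\<delta> / 2\<close>. If two eigenvectors were matched with the same \<open>v k\<close>, Bessel's inequality for \<open>v k\<close> would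
  force their combined defect to be at least 1, contradicting the bound on the total defect.
\<close>

lemma eigenbasis_perturbation:
  fixes \<Gamma> \<Lambda> :: "complex ^ 'n ^ 'n" and v w :: "'n \<Rightarrow> complex ^ 'n"
  assumes \<Gamma>: "hermitian \<Gamma>"
    and v: "orthonormal_on UNIV v" and ev: "\<And>j. \<Gamma> *v v j = complex_of_real (t j) *s v j"
    and w: "orthonormal_on UNIV w" and ew: "\<And>j. \<Lambda> *v w j = complex_of_real (\<mu> j) *s w j"
    and \<delta>: "0 < \<delta>" and gap: "\<And>j k. j \<noteq> k \<Longrightarrow> \<delta> \<le> \<bar>t j - t k\<bar>"
    and close: "2 * norm (\<Lambda> - \<Gamma>) < \<delta>"
  obtains \<pi> where "bij \<pi>"
    and "(\<Sum>i\<in>UNIV. 1 - (cmod (cinner (v (\<pi> i)) (w i)))\<^sup>2) \<le> (2 * norm (\<Lambda> - \<Gamma>) / \<delta>)\<^sup>2"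
proof -
  define X where "X = \<Lambda> - \<Gamma>"
  \<comment> \<open>The squared overlaps form a doubly stochastic matrix (\<open>row\<close> and
    \<open>col\<close>), and \<open>s i\<close> is the part of \<open>w i\<close> lying off its
    match \<open>v (\<pi> i)\<close>.\<close>
  define b where "b l i = (cmod (cinner (v l) (w i)))\<^sup>2" for l i
  define \<pi> where "\<pi> i = arg_min_on (\<lambda>k. \<bar>t k - \<mu> i\<bar>) UNIV" for i
  define s where "s i = (\<Sum>l\<in>UNIV - {\<pi> i}. b l i)" for i
  have row: "(\<Sum>l\<in>UNIV. b l i) = 1" for i
    using parseval[OF v, of "w i"] orthonormal_norm[OF w] by (simp add: b_def)
  have col: "(\<Sum>i\<in>UNIV. b l i) = 1" for l
  proof -
    have "cmod (cinner (w i) (v l)) = cmod (cinner (v l) (w i))" for i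
      by (metis cnj_cinner complex_mod_cnj)
    then show ?thesis
      using parseval[OF w, of "v l"] orthonormal_norm[OF v] by (simp add: b_def)
  qed
  have b_nonneg: "0 \<le> b l i" for l i by (simp add: b_def)
  have s_nonneg: "0 \<le> s i" for i by (simp add: s_def sum_nonneg b_nonneg)
  have s: "s i = 1 - b (\<pi> i) i" for i
    using row[of i] sum.remove[of UNIV "\<pi> i" "\<lambda>l. b l i"] by (simp add: s_def)
  \<comment> \<open>The distances from \<open>\<mu> i\<close> to \<open>t l\<close> and to
    \<open>t (\<pi> i)\<close> add up to at least \<open>\<delta>\<close>, and the former is the
    larger one.\<close>
  have far: "\<delta> / 2 \<le> \<bar>t l - \<mu> i\<bar>" if "l \<noteq> \<pi> i" for l i
  proof -
    have "\<bar>t (\<pi> i) - \<mu> i\<bar> \<le> \<bar>t l - \<mu> i\<bar>"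
      unfolding \<pi>_def by (rule arg_min_least) auto
    with gap[OF that] show ?thesis by linarith
  qed
  \<comment> \<open>\<open>\<Lambda>\<close> acts on \<open>w i\<close> from the left, while
    \<open>\<Gamma>\<close> is moved onto \<open>v l\<close>; the overlap is thereby multiplied by
    the difference of the two eigenvalues.\<close>
  have entry: "cinner (v l) (X *v w i) = of_real (\<mu> i - t l) * cinner (v l) (w i)" for l i
    by (simp add: X_def matrix_vector_mult_diff_rdistrib cinner_diff_right ew cinner_scale_right
        cinner_eigenvector_left[OF \<Gamma> ev] algebra_simps)
  have "(\<delta> / 2)\<^sup>2 * s i \<le> (norm (X *v w i))\<^sup>2" for i
  proof -
    have "(\<delta> / 2)\<^sup>2 * s i \<le> (\<Sum>l\<in>UNIV - {\<pi> i}. (t l - \<mu> i)\<^sup>2 * b l i)"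
      unfolding s_def sum_distrib_left
    proof (intro sum_mono mult_right_mono b_nonneg)
      fix l assume "l \<in> UNIV - {\<pi> i}"
      then have "\<bar>\<delta> / 2\<bar> \<le> \<bar>t l - \<mu> i\<bar>" using far[of l i] \<delta> by simp
      then show "(\<delta> / 2)\<^sup>2 \<le> (t l - \<mu> i)\<^sup>2" by (simp only: abs_le_square_iff)
    qed
    also have "\<dots> \<le> (\<Sum>l\<in>UNIV. (t l - \<mu> i)\<^sup>2 * b l i)"
      by (intro sum_mono2) (auto simp: b_nonneg)
    also have "\<dots> = (norm (X *v w i))\<^sup>2"
      unfolding parseval[OF v, of "X *v w i"]
      by (simp only: entry norm_mult power_mult_distrib norm_of_real power2_abs b_def power2_commute)
    finally show ?thesis .
  qed
  then have "(\<delta> / 2)\<^sup>2 * (\<Sum>i\<in>UNIV. s i) \<le> (norm X)\<^sup>2"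
    unfolding sum_distrib_left norm_orthonormal[OF w, of X] by (intro sum_mono)
  then have total: "(\<Sum>i\<in>UNIV. s i) \<le> (2 * norm X / \<delta>)\<^sup>2"
    using \<delta> by (simp add: field_simps)
  have "2 * norm X / \<delta> < 1"
    using close \<delta> by (simp add: X_def)
  then have small: "(2 * norm X / \<delta>)\<^sup>2 < 1"
    using \<delta> by (simp add: abs_square_less_1)
  have "inj \<pi>"
  proof (rule injI, rule ccontr)
    fix i i' assume eq: "\<pi> i = \<pi> i'" and ne: "i \<noteq> i'"
    have "b (\<pi> i) i + b (\<pi> i) i' = (\<Sum>k\<in>{i, i'}. b (\<pi> i) k)"
      using ne by simp
    also have "\<dots> \<le> (\<Sum>k\<in>UNIV. b (\<pi> i) k)"
      by (intro sum_mono2) (auto simp: b_nonneg)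
    finally have "1 \<le> s i + s i'"
      by (simp add: col s eq)
    also have "\<dots> = (\<Sum>k\<in>{i, i'}. s k)"
      using ne by simp
    also have "\<dots> \<le> (\<Sum>k\<in>UNIV. s k)"
      by (intro sum_mono2) (auto simp: s_nonneg)
    finally show False
      using total small by simp
  qed
  then have "bij \<pi>"
    by (simp add: bij_def finite_UNIV_inj_surj)
  with total that show thesis
    by (simp add: s b_def X_def)
qed

text \<open>In the eigenbasis of \<open>\<Gamma>\<close> the commutator multiplies the entries of
  \<open>G\<close> by \<open>t j - t k\<close>. It loses the diagonal, which \<open>diag\<close>
  makes zero, and every other factor has modulus at least \<open>\<delta>\<close>.\<close>

lemma commutator_norm_ge:
  fixes \<Gamma> G :: "complex ^ 'n ^ 'n" and v :: "'n \<Rightarrow> complex ^ 'n"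
  assumes \<Gamma>: "hermitian \<Gamma>"
    and v: "orthonormal_on UNIV v" and ev: "\<And>j. \<Gamma> *v v j = complex_of_real (t j) *s v j"
    and diag: "\<And>j. cinner (v j) (G *v v j) = 0"
    and \<delta>: "0 \<le> \<delta>" and gap: "\<And>j k. j \<noteq> k \<Longrightarrow> \<delta> \<le> \<bar>t j - t k\<bar>"
  shows "\<delta> * norm G \<le> norm (commutator \<Gamma> G)"
proof (rule power2_le_imp_le)
  have entries: "(norm A)\<^sup>2 = (\<Sum>k\<in>UNIV. \<Sum>j\<in>UNIV. (cmod (cinner (v j) (A *v v k)))\<^sup>2)"
    for A :: "complex ^ 'n ^ 'n"
    by (simp add: norm_orthonormal[OF v] parseval[OF v])
  have "cinner (v j) (commutator \<Gamma> G *v v k) = of_real (t j - t k) * cinner (v j) (G *v v k)" for j k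
    by (simp add: commutator_def matrix_vector_mult_diff_rdistrib cinner_diff_right ev
        vector_scalar_commute cinner_scale_right cinner_eigenvector_left[OF \<Gamma> ev] algebra_simps
        flip: matrix_vector_mul_assoc)
  moreover have "\<delta>\<^sup>2 * (cmod (cinner (v j) (G *v v k)))\<^sup>2
      \<le> (cmod (of_real (t j - t k) * cinner (v j) (G *v v k)))\<^sup>2" for j k
  proof (cases "j = k")
    case False
    then have "\<bar>\<delta>\<bar> \<le> \<bar>t j - t k\<bar>" using gap \<delta> by simp
    then have "\<delta>\<^sup>2 \<le> (t j - t k)\<^sup>2" by (simp only: abs_le_square_iff)
    then show ?thesis
      by (simp only: norm_mult power_mult_distrib norm_of_real power2_abs mult_right_mono zero_le_power2)
  qed (simp add: diag)
  ultimately show "(\<delta> * norm G)\<^sup>2 \<le> (norm (commutator \<Gamma> G))\<^sup>2"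
    by (simp only: power_mult_distrib entries sum_distrib_left) (intro sum_mono, simp)
qed simp

section \<open>Assembly of the estimate for the optimal measurement\<close>

theorem corollary5p7:
  fixes \<rho> \<sigma> :: "complex ^ 'n ^ 'n"
    and P :: "'n \<Rightarrow> complex ^ 'n ^ 'n"
  assumes "CARD('n) \<ge> 2"
    and "density_operator \<rho>" and "pos_def \<rho>"
    and "density_operator \<sigma>" and "pos_def \<sigma>"
    and "rank_one_pvm P"
    and "\<And>j k. j \<noteq> k \<Longrightarrow> score \<rho> \<sigma> P j \<noteq> score \<rho> \<sigma> P k"
    and "commutator_defect \<rho> \<sigma> P < lambda_min \<sigma> * (score_gap \<rho> \<sigma> P)\<^sup>2"
  shows "\<exists>Q :: 'n \<Rightarrow> complex ^ 'n ^ 'n.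
    rank_one_pvm Q \<and>
    ereal (pvm_div h1 \<rho> \<sigma> Q) = measured_div h1 \<rho> \<sigma> \<and>
    sqrt (1 / 2 * (\<Sum>j\<in>UNIV. (hs_norm (P j - Q j))\<^sup>2))
      \<le> sqrt (real CARD('n)) * commutator_defect \<rho> \<sigma> P / (lambda_min \<sigma> * (score_gap \<rho> \<sigma> P)\<^sup>2)"
proof -
  define t where "t = score \<rho> \<sigma> P"
  define \<delta> where "\<delta> = score_gap \<rho> \<sigma> P"
  define c where "c = commutator_defect \<rho> \<sigma> P"
  define \<Gamma> where "\<Gamma> = score_operator \<rho> \<sigma> P"
  define G where "G = residual_operator \<rho> \<sigma> P"
  define lam where "lam = lambda_min \<sigma>"
  obtain v where v: "orthonormal_on UNIV v" and P: "\<And>j. P j = rank_one_proj (v j)"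
    using assms(6) by (auto simp: rank_one_pvm_def orthonormal_on_def)
  have h\<rho>: "hermitian \<rho>" and h\<sigma>: "hermitian \<sigma>"
    using assms(3,5) by (simp_all add: pos_def_def)
  have lam: "0 < lam"
    unfolding lam_def by (rule lambda_min_pos[OF assms(5)])
  \<comment> \<open>As the image of a finite set the gap set is visibly finite, so its
    \<open>Min\<close> is a lower bound, attained once the set is nonempty.\<close>
  have gaps: "{\<bar>score \<rho> \<sigma> P j - score \<rho> \<sigma> P k\<bar> | j k. j \<noteq> k}
      = (\<lambda>(j, k). \<bar>t j - t k\<bar>) ` {(j, k). j \<noteq> k}"
    by (auto simp: t_def)
  have gap: "\<delta> \<le> \<bar>t j - t k\<bar>" if "j \<noteq> k" for j k
    unfolding \<delta>_def score_gap_def gaps using that by (intro Min_le) auto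
  \<comment> \<open>Dimension at least two supplies two different labels. The minimum is then one of
    the gaps, and distinct scores make it positive.\<close>
  have "card (UNIV :: 'n set) \<noteq> 1" using assms(1) by simp
  then obtain j0 k0 :: 'n where "j0 \<noteq> k0"
    by (metis (full_types) UNIV_I card_1_singleton_iff is_singletonI' is_singleton_altdef empty_iff)
  then have "\<delta> \<in> (\<lambda>(j, k). \<bar>t j - t k\<bar>) ` {(j, k). j \<noteq> k}"
    unfolding \<delta>_def score_gap_def gaps by (intro Min_in) auto
  then have \<delta>: "0 < \<delta>"
    using assms(7) by (auto simp: t_def)
  have \<Gamma>: "hermitian \<Gamma>"
    by (simp add: \<Gamma>_def score_operator_def hermitian_def cadjoint_sum cadjoint_scaleR P
        hermitian_rank_one_proj[unfolded hermitian_def])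
  have ev: "\<Gamma> *v v j = complex_of_real (t j) *s v j" for j
  proof -
    have "\<Gamma> *v v j = (\<Sum>k\<in>UNIV. if k = j then complex_of_real (t k) *s v k else 0)"
      unfolding \<Gamma>_def score_operator_def matrix_sum_mult_vec
      using v by (intro sum.cong)
        (auto simp: scaleR_mult_vec P rank_one_proj_mult_vec orthonormal_on_def t_def of_real_vector_scale)
    then show ?thesis by simp
  qed
  \<comment> \<open>The diagonal entry is \<open>2 * p - 2 * (t j * q)\<close>, which vanishes
    because the score is \<open>p / q\<close> with \<open>0 < q\<close>.\<close>
  have diag: "cinner (v j) (G *v v j) = 0" for j
  proof -
    define p q where "p = outcome_prob \<rho> (P j)" and "q = outcome_prob \<sigma> (P j)"
    have p: "cinner (v j) (\<rho> *v v j) = of_real p"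
      using cinner_hermitian_self[OF h\<rho>]
      by (simp add: p_def outcome_prob_def P trace_mult_rank_one_proj)
    have q: "cinner (v j) (\<sigma> *v v j) = of_real q"
      using cinner_hermitian_self[OF h\<sigma>]
      by (simp add: q_def outcome_prob_def P trace_mult_rank_one_proj)
    have "v j \<noteq> 0" using orthonormal_norm[OF v, of j] by auto
    then have "0 < q"
      using assms(5) q by (auto simp: pos_def_def)
    then have "t j * q = p"
      by (simp add: t_def score_def p_def q_def)
    moreover have "cinner (v j) (G *v v j) = of_real (2 * p - 2 * (t j * q))"
      by (simp add: G_def residual_operator_def matrix_vector_mult_diff_rdistrib cinner_diff_right
          scaleR_mult_vec cinner_scaleR_right p q ev vector_scalar_commute cinner_scale_right
          cinner_eigenvector_left[OF \<Gamma> ev] flip: matrix_vector_mul_assoc \<Gamma>_def)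
    ultimately show ?thesis by simp
  qed
  have "hermitian (2 *\<^sub>R \<rho>)"
    using h\<rho> by (simp add: hermitian_def cadjoint_scaleR)
  then obtain \<Lambda> where lyap: "\<sigma> ** \<Lambda> + \<Lambda> ** \<sigma> = 2 *\<^sub>R \<rho>" and \<Lambda>: "hermitian \<Lambda>"
    using lyapunov_hermitian_solution[OF assms(5)] by blast
  have "\<sigma> ** (\<Lambda> - \<Gamma>) + (\<Lambda> - \<Gamma>) ** \<sigma> = G"
    by (simp add: G_def residual_operator_def matrix_diff_ldistrib matrix_diff_rdistrib algebra_simps
        flip: lyap \<Gamma>_def)
  then have "2 * lam * norm (\<Lambda> - \<Gamma>) \<le> norm G"
    using lyapunov_norm_le[OF assms(5), of "\<Lambda> - \<Gamma>"] by (simp add: lam_def)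
  moreover have "\<delta> * norm G \<le> c"
    using commutator_norm_ge[OF \<Gamma> v ev diag, of \<delta>] \<delta> gap
    by (simp add: c_def commutator_defect_def hs_norm_eq_norm \<Gamma>_def G_def)
  ultimately have "\<delta> * (2 * lam * norm (\<Lambda> - \<Gamma>)) \<le> c"
    using \<delta> by (meson less_imp_le mult_left_mono order_trans)
  then have bound: "2 * norm (\<Lambda> - \<Gamma>) / \<delta> \<le> c / (lam * \<delta>\<^sup>2)"
    using lam \<delta> by (simp add: field_simps power2_eq_square)
  also have "\<dots> < 1"
    using assms(8) lam \<delta> by (simp add: c_def lam_def \<delta>_def)
  finally have close: "2 * norm (\<Lambda> - \<Gamma>) < \<delta>"
    using \<delta> by simp
  obtain w :: "'n \<Rightarrow> complex ^ 'n" and \<mu> where w: "orthonormal_on UNIV w"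
    and ew: "\<And>j. \<Lambda> *v w j = complex_of_real (\<mu> j) *s w j"
    using hermitian_eigenbasis[OF \<Lambda>] by blast
  obtain \<pi> where \<pi>: "bij \<pi>"
    and dist: "(\<Sum>i\<in>UNIV. 1 - (cmod (cinner (v (\<pi> i)) (w i)))\<^sup>2) \<le> (2 * norm (\<Lambda> - \<Gamma>) / \<delta>)\<^sup>2"
    using eigenbasis_perturbation[OF \<Gamma> v ev w ew \<delta> gap close] by blast
  \<comment> \<open>Relabelling by the matching: the vector \<open>w i\<close> receives the label
    \<open>\<pi> i\<close> of the eigenvector of \<open>\<Gamma>\<close> closest to it in
    eigenvalue.\<close>
  define w' where "w' = w \<circ> inv \<pi>"
  define Q where "Q j = rank_one_proj (w' j)" for j
  have "inj (inv \<pi>)" using \<pi> by (simp add: bij_imp_bij_inv bij_is_inj)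
  then have w': "orthonormal_on UNIV w'"
    using w by (simp add: w'_def orthonormal_on_def inj_eq)
  have "rank_one_pvm Q"
    using w' unfolding rank_one_pvm_def orthonormal_on_def Q_def by blast
  moreover have "ereal (pvm_div h1 \<rho> \<sigma> Q) = measured_div h1 \<rho> \<sigma>"
    unfolding Q_def
    by (rule eigenbasis_optimal[OF pos_def_imp_pos_semidef[OF assms(5)] \<Lambda> lyap w', of "\<mu> \<circ> inv \<pi>"])
      (simp add: w'_def ew)
  moreover have "sqrt (1 / 2 * (\<Sum>j\<in>UNIV. (hs_norm (P j - Q j))\<^sup>2)) \<le> sqrt (real CARD('n)) * c / (lam * \<delta>\<^sup>2)"
  proof -
    have "(\<Sum>j\<in>UNIV. (hs_norm (P j - Q j))\<^sup>2) = (\<Sum>i\<in>UNIV. (hs_norm (P (\<pi> i) - Q (\<pi> i)))\<^sup>2)"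
      by (rule sum.reindex_bij_betw[OF \<pi>, symmetric])
    also have "\<dots> = (\<Sum>i\<in>UNIV. 2 * (1 - (cmod (cinner (v (\<pi> i)) (w i)))\<^sup>2))"
      using \<pi> orthonormal_norm[OF v] orthonormal_norm[OF w]
      by (simp add: hs_norm_eq_norm P Q_def w'_def norm_rank_one_proj_diff bij_is_inj)
    also have "\<dots> = 2 * (\<Sum>i\<in>UNIV. 1 - (cmod (cinner (v (\<pi> i)) (w i)))\<^sup>2)"
      by (simp only: sum_distrib_left)
    finally have "1 / 2 * (\<Sum>j\<in>UNIV. (hs_norm (P j - Q j))\<^sup>2) \<le> (2 * norm (\<Lambda> - \<Gamma>) / \<delta>)\<^sup>2"
      using dist by simp
    then have "sqrt (1 / 2 * (\<Sum>j\<in>UNIV. (hs_norm (P j - Q j))\<^sup>2)) \<le> 2 * norm (\<Lambda> - \<Gamma>) / \<delta>"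
      using \<delta> by (intro real_le_lsqrt) auto
    also note bound
    \<comment> \<open>The chain so far has constant 1. Since the bound is nonnegative and the
      dimension factor is at least 1, the stated form follows.\<close>
    also have "c / (lam * \<delta>\<^sup>2) \<le> sqrt (real CARD('n)) * (c / (lam * \<delta>\<^sup>2))"
    proof -
      have "0 \<le> 2 * norm (\<Lambda> - \<Gamma>) / \<delta>" using \<delta> by simp
      then have "0 \<le> c / (lam * \<delta>\<^sup>2)" using bound by linarith
      moreover have "1 \<le> sqrt (real CARD('n))" using assms(1) by simp
      ultimately show ?thesis
        using mult_right_mono[of 1 "sqrt (real CARD('n))" "c / (lam * \<delta>\<^sup>2)"] by simp
    qed
    finally show ?thesis by simp
  qed
  ultimately show ?thesis
    unfolding c_def lam_def \<delta>_def by blast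
qed

end
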